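(* Let $A:\mathbb{F}^d\to\mathbb{F}^d$ be a linear operator and let $b_1,\dots,b_L\in\mathbb{F}^d\setminus\{\mathbf{0}\}$. Then the subspace $$\mathcal{O}(b_1,\dots,b_L)=\mathrm{span}\left\{\begin{bmatrix}A^n b_\ell\\ \Lambda_n b_\ell\end{bmatrix}\in\mathbb{F}^{2d}: n\in\mathbb{N}_0,\ \ell=1,\dots,L\right\}$$ coincides with the set of vectors $$\left\{\begin{bmatrix}(A-I)g+\sum_{\ell=1}^L\mu_\ell b_\ell\\ g\end{bmatrix}\in\mathbb{F}^{2d}: g\in Z(A;b_1,\dots,b_L),\ \mu_1,\dots,\mu_L\in\mathbb{F}\right\}.$$ In particular, $\dim\mathcal{O}(b_1,\dots,b_L)\le\min\{d+L,2d\}$.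
   Context: $\mathbb{F}$ is $\mathbb{R}$ or $\mathbb{C}$, $\mathbb{N}_0=\{0,1,2,\dots\}$, and $I$ is the identity. $\Lambda_0:=\mathbf{0}$ (the zero matrix) and $\Lambda_n:=\sum_{j=0}^{n-1}A^j$ for $n\ge 1$. $Z(A;b_1,\dots,b_L):=\mathrm{span}\{A^n b_\ell: n\in\mathbb{N}_0,\ \ell\in\{1,\dots,L\}\}\subseteq\mathbb{F}^d$ is the observational orbits space. *)

theory Defs
  imports "HOL-Analysis.Analysis"
begin

text \<open>
  The scalars are a type \<open>'a::real_normed_field\<close>.  Since the norm in this class is multiplicative,
  the Gelfand--Mazur theorem says that such a type is, up to isomorphism, the reals or the complex
  numbers; both are instances.  \<open>\<F>^d\<close> is the type \<open>'a^'n\<close> with \<open>d = CARD('n)\<close>, and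
  \<open>\<F>^(2d)\<close> is \<open>'a^('n + 'n)\<close>.  Linearity, span and dimension are taken over \<open>'a\<close> (via \<open>*s\<close>), not
  over the reals.
\<close>

definition block_vec :: "'a^'n \<Rightarrow> 'a^'n \<Rightarrow> 'a^('n + 'n)" where
  "block_vec u v = (\<chi> i. case i of Inl j \<Rightarrow> u $ j | Inr j \<Rightarrow> v $ j)"

text \<open>For \<open>n = 0\<close> the sum is empty, so \<open>Lambda_op A 0\<close> is the zero operator.\<close>

definition Lambda_op :: "('a::real_normed_field^'n \<Rightarrow> 'a^'n) \<Rightarrow> nat \<Rightarrow> 'a^'n \<Rightarrow> 'a^'n" where
  "Lambda_op A n x = (\<Sum>j<n. (A ^^ j) x)"

text \<open>The finite family \<open>b 1, \<dots>, b L\<close> is a function on \<open>nat\<close> used only on \<open>{1..L}\<close>.\<close>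

definition obs_orbits_space ::
  "('a::real_normed_field^'n \<Rightarrow> 'a^'n) \<Rightarrow> (nat \<Rightarrow> 'a^'n) \<Rightarrow> nat \<Rightarrow> ('a^'n) set" where
  "obs_orbits_space A b L = vec.span {(A ^^ n) (b l) | n l. l \<in> {1..L}}"

definition block_orbits_space ::
  "('a::real_normed_field^'n \<Rightarrow> 'a^'n) \<Rightarrow> (nat \<Rightarrow> 'a^'n) \<Rightarrow> nat \<Rightarrow> ('a^('n + 'n)) set" where
  "block_orbits_space A b L =
     vec.span {block_vec ((A ^^ n) (b l)) (Lambda_op A n (b l)) | n l. l \<in> {1..L}}"

end

theory Submission
  imports Defs
begin

text \<open>
  Since \<open>\<Lambda>\<^sub>n b = b + A b + \<dots> + A\<^bsup>n-1\<^esup> b\<close>, telescoping gives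
  \<open>A\<^sup>n b = (A - I) \<Lambda>\<^sub>n b + b\<close>, so each generator is \<open>\<phi> (\<Lambda>\<^sub>n b) + (b, 0)\<close> with
  \<open>\<phi> g = ((A - I) g, g)\<close> linear. The summand \<open>(b, 0)\<close> is the generator with \<open>n = 0\<close>, and
  differences of consecutive \<open>\<phi> (\<Lambda>\<^sub>n b)\<close> give \<open>\<phi> (A\<^sup>n b)\<close>; hence the orbit space is
  \<open>\<phi> Z + span (b\<^sub>l, 0)\<close>, which lies in the span of \<open>d + L\<close> vectors.
\<close>

lemma block_vec_add: "block_vec (u + u') (v + v') = block_vec u v + block_vec u' v'"
  by (simp add: block_vec_def vec_eq_iff split: sum.split)

lemma block_vec_scale: "block_vec (c *s u) (c *s v) = c *s block_vec u v"
  by (simp add: block_vec_def vec_eq_iff split: sum.split)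

lemma block_vec_sum: "block_vec (\<Sum>i\<in>I. f i) 0 = (\<Sum>i\<in>I. block_vec (f i) 0)"
  by (simp add: block_vec_def vec_eq_iff split: sum.split)

lemma linear_block_vec:
  fixes f g :: "'a::field^'n \<Rightarrow> 'a^'m"
  assumes f: "Vector_Spaces.linear (*s) (*s) f" and g: "Vector_Spaces.linear (*s) (*s) g"
  shows "Vector_Spaces.linear (*s) (*s) (\<lambda>x. block_vec (f x) (g x))"
proof -
  interpret f: Vector_Spaces.linear "(*s)" "(*s)" f by (fact f)
  interpret g: Vector_Spaces.linear "(*s)" "(*s)" g by (fact g)
  show ?thesis
    by unfold_locales (simp_all add: f.add g.add f.scale g.scale block_vec_add block_vec_scale)
qed

lemma linear_sub_id:
  fixes A :: "'a::field^'n \<Rightarrow> 'a^'n"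
  assumes "Vector_Spaces.linear (*s) (*s) A"
  shows "Vector_Spaces.linear (*s) (*s) (\<lambda>x. A x - x)"
proof -
  interpret A: Vector_Spaces.linear "(*s)" "(*s)" A by (fact assms)
  show ?thesis
    by unfold_locales (simp_all add: A.add A.scale vec.scale_right_diff_distrib)
qed

lemma linear_shift_block:
  fixes A :: "'a::field^'n \<Rightarrow> 'a^'n"
  assumes "Vector_Spaces.linear (*s) (*s) A"
  shows "Vector_Spaces.linear (*s) (*s) (\<lambda>g. block_vec (A g - g) g)"
  by (intro linear_block_vec linear_sub_id assms vec.linear_ident)

text \<open>Induction on \<open>n\<close>: the new summand \<open>(A ^^ n) x\<close> of
  \<open>Lambda_op\<close> changes the right-hand side by
  \<open>(A ^^ Suc n) x - (A ^^ n) x\<close>.\<close>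

lemma Lambda_op_telescope:
  assumes "Vector_Spaces.linear (*s) (*s) A"
  shows "(A ^^ n) x = (A (Lambda_op A n x) - Lambda_op A n x) + x"
proof -
  interpret A: Vector_Spaces.linear "(*s)" "(*s)" A by (fact assms)
  show ?thesis
  proof (induction n)
    case 0
    show ?case by (simp add: Lambda_op_def A.zero)
  next
    case (Suc n)
    have "Lambda_op A (Suc n) x = Lambda_op A n x + (A ^^ n) x"
      by (simp add: Lambda_op_def)
    \<comment> \<open>The inner bracket is the right-hand side of the induction hypothesis, so it
      cancels against \<open>(A ^^ n) x\<close>.\<close>
    then have "A (Lambda_op A (Suc n) x) - Lambda_op A (Suc n) x + x =
      (A ^^ Suc n) x + ((A (Lambda_op A n x) - Lambda_op A n x + x) - (A ^^ n) x)"
      by (simp add: A.add)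
    then show ?case unfolding Suc.IH[symmetric] by simp
  qed
qed

lemma block_vec_generator:
  assumes "Vector_Spaces.linear (*s) (*s) A"
  shows "block_vec ((A ^^ n) x) (Lambda_op A n x) =
    block_vec (A (Lambda_op A n x) - Lambda_op A n x) (Lambda_op A n x) + block_vec x 0"
  by (subst Lambda_op_telescope[OF assms]) (simp flip: block_vec_add)

text \<open>Coefficients are attached to indices rather than to vectors, so \<open>f\<close> may
  repeat values; this is the role of the scalars \<mu> in the main result.\<close>

lemma span_finite_family:
  assumes "finite I"
  shows "vec.span (f ` I) = range (\<lambda>\<mu>. \<Sum>i\<in>I. \<mu> i *s f i)"
proof
  have "\<exists>\<mu>. x = (\<Sum>i\<in>I. \<mu> i *s f i)" if "x \<in> vec.span (f ` I)" for x
    using that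
  proof (induction rule: vec.span_induct_alt)
    case base
    show ?case by (rule exI[of _ "\<lambda>_. 0"]) simp
  next
    case (step c v y)
    then obtain i \<mu> where i: "i \<in> I" "v = f i" and y: "y = (\<Sum>i\<in>I. \<mu> i *s f i)" by blast
    \<comment> \<open>All of \<open>c\<close> goes to the single chosen index \<open>i\<close>, even
      if other indices also map to \<open>v\<close>.\<close>
    have "c *s v = (\<Sum>j\<in>I. (if j = i then c else 0) *s f j)"
      using assms i by (subst sum.remove[of _ i]) auto
    then have "c *s v + y = (\<Sum>j\<in>I. ((if j = i then c else 0) + \<mu> j) *s f j)"
      by (simp only: y vec.scale_left_distrib sum.distrib)
    then show ?case by (intro exI[of _ "\<lambda>j. (if j = i then c else 0) + \<mu> j"])
  qed
  then show "vec.span (f ` I) \<subseteq> range (\<lambda>\<mu>. \<Sum>i\<in>I. \<mu> i *s f i)" by blast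
  show "range (\<lambda>\<mu>. \<Sum>i\<in>I. \<mu> i *s f i) \<subseteq> vec.span (f ` I)"
    by (blast intro: vec.span_sum vec.span_scale vec.span_base)
qed

lemma Lambda_op_in_orbits:
  assumes "l \<in> {1..L}"
  shows "Lambda_op A n (b l) \<in> obs_orbits_space A b L"
  unfolding Lambda_op_def obs_orbits_space_def
  using assms by (blast intro: vec.span_sum vec.span_base)

lemma block_orbits_space_eq_span:
  assumes lin: "Vector_Spaces.linear (*s) (*s) A"
  shows "block_orbits_space A b L =
    vec.span ((\<lambda>g. block_vec (A g - g) g) ` obs_orbits_space A b L
      \<union> (\<lambda>l. block_vec (b l) 0) ` {1..L})"
    (is "_ = vec.span (?\<phi> ` ?Z \<union> ?B)")
proof -
  interpret \<phi>: Vector_Spaces.linear "(*s)" "(*s)" ?\<phi> by (rule linear_shift_block[OF lin])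
  let ?gen = "\<lambda>n l. block_vec ((A ^^ n) (b l)) (Lambda_op A n (b l))"
  let ?G = "{?gen n l | n l. l \<in> {1..L}}"
  have gen: "?gen n l = ?\<phi> (Lambda_op A n (b l)) + block_vec (b l) 0" for n l
    by (rule block_vec_generator[OF lin])
  have "?G \<subseteq> vec.span (?\<phi> ` ?Z \<union> ?B)"
    unfolding gen using Lambda_op_in_orbits
    by (blast intro: vec.span_add vec.span_base)
  moreover have B: "block_vec (b l) 0 \<in> vec.span ?G" if "l \<in> {1..L}" for l
  proof -
    \<comment> \<open>At exponent 0 the sum in \<open>Lambda_op\<close> is empty, so the lower block
      vanishes.\<close>
    have "?gen 0 l = block_vec (b l) 0" by (simp add: Lambda_op_def)
    then show ?thesis using that by (metis (mono_tags, lifting) mem_Collect_eq vec.span_base)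
  qed
  moreover have "?\<phi> ((A ^^ n) (b l)) \<in> vec.span ?G" if "l \<in> {1..L}" for n l
  proof -
    have "(A ^^ n) (b l) = Lambda_op A (Suc n) (b l) - Lambda_op A n (b l)"
      by (simp add: Lambda_op_def)
    \<comment> \<open>Both generators carry the same summand \<open>block_vec (b l) 0\<close>, which
      drops out of the difference.\<close>
    then have "?\<phi> ((A ^^ n) (b l)) = ?gen (Suc n) l - ?gen n l"
      unfolding gen by (simp only: \<phi>.diff) simp
    moreover have "?gen m l \<in> vec.span ?G" for m
      using that by (blast intro: vec.span_base)
    ultimately show ?thesis by (simp only: vec.span_diff)
  qed
  then have "?\<phi> ` ?Z \<subseteq> vec.span ?G"
    \<comment> \<open>By linearity the image of the span is the span of the images, so checking the
      vectors \<open>(A ^^ n) (b l)\<close> suffices.\<close>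
    unfolding obs_orbits_space_def \<phi>.span_image[symmetric]
    by (intro vec.span_minimal) auto
  ultimately show ?thesis
    unfolding block_orbits_space_def
    by (intro equalityI vec.span_minimal) auto
qed

lemma dim_block_orbits_space_le:
  fixes A :: "'a::real_normed_field^'n \<Rightarrow> 'a^'n"
  assumes lin: "Vector_Spaces.linear (*s) (*s) A"
  shows "vec.dim (block_orbits_space A b L) \<le> CARD('n) + L"
proof -
  let ?\<phi> = "\<lambda>g. block_vec (A g - g) g"
  interpret \<phi>: Vector_Spaces.linear "(*s)" "(*s)" ?\<phi> by (rule linear_shift_block[OF lin])
  let ?E = "?\<phi> ` cart_basis" and ?B = "(\<lambda>l. block_vec (b l) 0) ` {1..L}"
  \<comment> \<open>Enlarging the orbit space to all of the domain gives a spanning set of at most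
    \<open>CARD('n)\<close> vectors for the first part.\<close>
  have "vec.span ?E = range ?\<phi>"
    by (simp add: \<phi>.span_image span_cart_basis)
  then have "?\<phi> ` obs_orbits_space A b L \<subseteq> vec.span (?E \<union> ?B)"
    using vec.span_mono[of ?E "?E \<union> ?B"] by blast
  then have "block_orbits_space A b L \<subseteq> vec.span (?E \<union> ?B)"
    unfolding block_orbits_space_eq_span[OF lin]
    by (intro vec.span_minimal) (auto intro: vec.span_base)
  then have "vec.dim (block_orbits_space A b L) \<le> card (?E \<union> ?B)"
    by (rule vec.dim_le_card) (simp add: finite_cart_basis)
  also have "\<dots> \<le> card ?E + card ?B" by (rule card_Un_le)
  also have "\<dots> \<le> card (cart_basis :: ('a^'n) set) + card {1..L}"
    by (intro add_mono card_image_le finite_cart_basis finite_atLeastAtMost)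
  finally show ?thesis by (simp add: card_cart_basis)
qed

theorem theorem2p1:
  fixes A :: "'a::real_normed_field^'n \<Rightarrow> 'a^'n"
    and b :: "nat \<Rightarrow> 'a^'n" and L :: nat
  assumes "Vector_Spaces.linear (*s) (*s) A"
    and "\<And>l. l \<in> {1..L} \<Longrightarrow> b l \<noteq> 0"
  shows "block_orbits_space A b L =
           {block_vec ((A g - g) + (\<Sum>l = 1..L. \<mu> l *s b l)) g | g \<mu>.
              g \<in> obs_orbits_space A b L}
         \<and> vec.dim (block_orbits_space A b L) \<le> min (CARD('n) + L) (2 * CARD('n))"
proof
  let ?\<phi> = "\<lambda>g. block_vec (A g - g) g" and ?Z = "obs_orbits_space A b L"
  let ?\<beta> = "\<lambda>l. block_vec (b l) 0"
  interpret \<phi>: Vector_Spaces.linear "(*s)" "(*s)" ?\<phi> by (rule linear_shift_block[OF assms(1)])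
  have "\<mu> l *s ?\<beta> l = block_vec (\<mu> l *s b l) 0" for \<mu> l
    using block_vec_scale[of "\<mu> l" "b l" 0] by simp
  then have "block_vec (\<Sum>l = 1..L. \<mu> l *s b l) 0 = (\<Sum>l = 1..L. \<mu> l *s ?\<beta> l)" for \<mu>
    by (simp add: block_vec_sum)
  then have decomp: "block_vec ((A g - g) + (\<Sum>l = 1..L. \<mu> l *s b l)) g = ?\<phi> g + (\<Sum>l = 1..L. \<mu> l *s ?\<beta> l)"
    for g \<mu>
    using block_vec_add[of "A g - g" "\<Sum>l = 1..L. \<mu> l *s b l" g 0] by simp
  \<comment> \<open>The image of a subspace is a subspace, so \<open>vec.span_Un\<close> will leave
    sums of one vector \<open>?\<phi> g\<close> and one combination of the
    \<open>?\<beta> l\<close>.\<close>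
  have span_Z: "vec.span (?\<phi> ` ?Z) = ?\<phi> ` ?Z"
    by (simp only: \<phi>.span_image obs_orbits_space_def vec.span_span)
  show "block_orbits_space A b L =
           {block_vec ((A g - g) + (\<Sum>l = 1..L. \<mu> l *s b l)) g | g \<mu>. g \<in> ?Z}"
    unfolding block_orbits_space_eq_span[OF assms(1)] vec.span_Un span_Z decomp
      span_finite_family[OF finite_atLeastAtMost]
    by blast
next
  \<comment> \<open>The bound \<open>2 * CARD('n)\<close> is the dimension of the ambient
    space.\<close>
  have "vec.dim (block_orbits_space A b L) \<le> CARD('n + 'n)"
    unfolding vec_dim_card[symmetric, where 'a = 'a] by (intro vec.dim_subset subset_UNIV)
  then show "vec.dim (block_orbits_space A b L) \<le> min (CARD('n) + L) (2 * CARD('n))"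
    using dim_block_orbits_space_le[OF assms(1)] by simp
qed

end
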